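(* Let $A\in\mathbb{R}^{m\times n}$ have full column rank and let $b\in\mathbb{R}^m$ be such that the linear system $Ax=b$ is consistent. Let $\mathcal{D}$ be a distribution of random matrix quadruples $(S_1,S_2,T_1,T_2)$ satisfying $\mathbb{E}[T_1T_2^\top A^\top S_1S_2^\top]=\frac{A^\top}{\|A\|_F^2}$. Let $x^1=x^0\in\mathbb{R}^n$ be (deterministic) initial vectors and let $\{x^k\}$ be generated by the mPFR iteration $$x^{k+1}=x^{k}-\alpha T_1T_2^\top A^\top S_1S_2^\top(Ax^{k}-b)+\omega(x^k-x^{k-1}),\qquad k\ge 1,$$ where at each iteration a fresh quadruple $(S_1,S_2,T_1,T_2)$ is drawn independently from $\mathcal{D}$. Denote $$\beta_1=\|\mathbb{E}[ S_2S_1^\top AT_2T_1^\top T_1T_2^\top A^\top S_1S_2^\top ]\|_2.$$ Assume $0<\alpha<\frac{2}{\beta_1\|A\|^2_F}$, $\omega\geq0$, and that the expressions $$\gamma_1=1+3\omega+2\omega^2-\left(2\alpha+\alpha\omega-\alpha^2\beta_1\|A\|^2_F\right)\frac{\sigma_{\min}^2(A)}{\|A\|^2_F}\quad\text{and}\quad\gamma_2=2\omega^2+\omega+\omega\alpha\frac{\sigma^2_{\max}(A)}{\|A\|^2_F}$$ satisfy $\gamma_1+\gamma_2<1$. Then $$\mathbb{E}[\|x^{k+1}-A^{\dagger}b\|^2_2]\leq q^k(1+\tau)\|x^0-A^{\dagger}b\|^2_2\qquad\text{for all } k\geq 0,$$ where $q=\frac{\gamma_1+\sqrt{\gamma_1^2+4\gamma_2}}{2}$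 if $\omega>0$, $q=\gamma_1$ if $\omega=0$, and $\tau=q-\gamma_1\geq 0$. Moreover, $\gamma_1+\gamma_2\leq q<1$.
   Context: $A^\dagger$ is the Moore-Penrose pseudoinverse; $\|\cdot\|_F$ is the Frobenius norm; $\|\cdot\|_2$ is the Euclidean norm of a vector or the spectral norm of a matrix; $\sigma_{\max}(A)$ is the largest singular value and $\sigma_{\min}(A)$ the smallest nonzero singular value of $A$. The random matrices have sizes $S_1,S_2\in\mathbb{R}^{m\times p}$ and $T_1,T_2\in\mathbb{R}^{n\times s}$, where $p,s$ may themselves be random; the four matrices in a quadruple need not be independent of each other, but quadruples used at different iterations are independent and identically distributed. All expectations appearing are assumed to exist and be finite. *)

theory Defs
  imports "HOL-Probability.Probability"
begin

abbreviation frobenius_norm :: "real^'n^'m \<Rightarrow> real" where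
  "frobenius_norm A \<equiv> norm A"

lemma frobenius_norm_entries:
  fixes A :: "real^'n^'m"
  shows "frobenius_norm A = sqrt (\<Sum>i\<in>UNIV. \<Sum>j\<in>UNIV. (A $ i $ j)\<^sup>2)"
  by (simp add: norm_vec_def L2_set_def sum_nonneg)

abbreviation spectral_norm :: "real^'n^'m \<Rightarrow> real" where
  "spectral_norm A \<equiv> onorm ((*v) A)"

text \<open>The Moore-Penrose pseudoinverse, as the unique solution of the four Penrose equations.\<close>

definition pinv :: "real^'n^'m \<Rightarrow> real^'m^'n" where
  "pinv A = (THE X. A ** X ** A = A \<and> X ** A ** X = X \<and>
                    transpose (A ** X) = A ** X \<and> transpose (X ** A) = X ** A)"

text \<open>Singular values are the square roots of the eigenvalues of \<open>A\<^sup>T A\<close>. For fewer rows than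
  columns this set contains 0 even when the usual list of singular values does not;
  this affects neither the largest nor the smallest nonzero one.\<close>

definition singular_values :: "real^'n^'m \<Rightarrow> real set" where
  "singular_values A =
     {sqrt l | l. \<exists>v. v \<noteq> 0 \<and> (transpose A ** A) *v v = l *\<^sub>R v}"

definition sigma_max :: "real^'n^'m \<Rightarrow> real" where
  "sigma_max A = Max (singular_values A)"

definition sigma_min :: "real^'n^'m \<Rightarrow> real" where
  "sigma_min A = Min (singular_values A - {0})"

text \<open>A quadruple \<open>(S\<^sub>1, S\<^sub>2, T\<^sub>1, T\<^sub>2)\<close> whose widths may vary from sample to sample is
  encoded as \<open>(p, S\<^sub>1, S\<^sub>2, s, T\<^sub>1, T\<^sub>2)\<close>, with each matrix given by its sequence of columns: only
  the columns with index below \<open>p\<close> (for \<open>S\<^sub>1, S\<^sub>2\<close>) or \<open>s\<close> (for \<open>T\<^sub>1, T\<^sub>2\<close>) belong to the matrix,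
  and the later ones are never used. The Borel sets of this type (discrete topology on the widths,
  product topology on the column sequences) make precisely the widths and all entries
  measurable.\<close>

type_synonym ('m, 'n) quadruple =
  "nat \<times> (nat \<Rightarrow> real^'m) \<times> (nat \<Rightarrow> real^'m) \<times> nat \<times> (nat \<Rightarrow> real^'n) \<times> (nat \<Rightarrow> real^'n)"

text \<open>\<open>mult_transp p U V\<close> is the matrix product \<open>U V\<^sup>T\<close> of two matrices with \<open>p\<close> columns.\<close>

definition mult_transp :: "nat \<Rightarrow> (nat \<Rightarrow> real^'a) \<Rightarrow> (nat \<Rightarrow> real^'b) \<Rightarrow> real^'b^'a" where
  "mult_transp p U V = (\<chi> i j. \<Sum>l<p. U l $ i * V l $ j)"

text \<open>\<open>T\<^sub>1 T\<^sub>2\<^sup>T A\<^sup>T S\<^sub>1 S\<^sub>2\<^sup>T\<close>\<close>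

definition sketch :: "real^'n^'m \<Rightarrow> ('m, 'n) quadruple \<Rightarrow> real^'m^'n" where
  "sketch A = (\<lambda>(p, S1, S2, s, T1, T2).
     mult_transp s T1 T2 ** transpose A ** mult_transp p S1 S2)"

text \<open>\<open>S\<^sub>2 S\<^sub>1\<^sup>T A T\<^sub>2 T\<^sub>1\<^sup>T T\<^sub>1 T\<^sub>2\<^sup>T A\<^sup>T S\<^sub>1 S\<^sub>2\<^sup>T\<close>\<close>

definition sketch_gram :: "real^'n^'m \<Rightarrow> ('m, 'n) quadruple \<Rightarrow> real^'m^'m" where
  "sketch_gram A = (\<lambda>(p, S1, S2, s, T1, T2).
     mult_transp p S2 S1 ** A ** mult_transp s T2 T1 **
     mult_transp s T1 T2 ** transpose A ** mult_transp p S1 S2)"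

end

theory Submission
  imports Defs
begin

text \<open>Let \<open>e = A\<^sup>\<dagger> b\<close>, so that \<open>A e = b\<close>, and let \<open>E\<^sub>k\<close> be the expected squared error of \<open>x\<^sup>k\<close>. The
  quadruple of step \<open>k\<close> is independent of \<open>(x\<^sup>k, x\<^sup>k\<^sup>-\<^sup>1)\<close>, so by Tonelli one step may be averaged over
  it with the past held fixed. The average is a quadratic form in the two last errors, and bounding
  \<open>\<parallel>A r\<parallel>\<^sup>2\<close> by the extreme singular values gives \<open>E\<^sub>k\<^sub>+\<^sub>1 \<le> \<gamma>\<^sub>1 E\<^sub>k + \<gamma>\<^sub>2 E\<^sub>k\<^sub>-\<^sub>1\<close>. As \<open>q\<close> is the
  larger root of \<open>q\<^sup>2 = \<gamma>\<^sub>1 q + \<gamma>\<^sub>2\<close>, the quantity \<open>E\<^sub>k\<^sub>+\<^sub>1 + (q - \<gamma>\<^sub>1) E\<^sub>k\<close> contracts by the factor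
  \<open>q\<close>.\<close>

section \<open>The pseudoinverse under full column rank\<close>

lemma matrix_vector_inner_transpose:
  fixes A :: "real^'n^'m"
  shows "(A *v u) \<bullet> v = u \<bullet> (transpose A *v v)"
  by (simp add: adjoint_matrix flip: adjoint_clauses(1)[OF matrix_vector_mul_linear])

text \<open>Injectivity of \<open>A\<close> makes \<open>P = transpose A ** A\<close> invertible, so
  \<open>P^-1 ** transpose A\<close> solves the Penrose equations. Uniqueness must be shown too,
  since \<open>pinv\<close> is a definite description. The identity turns consistency of
  \<open>A z = b\<close> into \<open>A (pinv A b) = b\<close>.\<close>

lemma pinv_full_column_rank:
  fixes A :: "real^'n^'m"
  assumes "rank A = CARD('n)"
  shows "A ** pinv A ** A = A"
proof -
  have inj: "inj ((*v) A)"
    using assms by (simp add: full_rank_injective)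
  have cancel: "X = Y" if "A ** X = A ** Y" for X Y :: "real^'k^'n"
  proof -
    obtain B where "B ** A = mat 1"
      using inj matrix_left_invertible_injective[of A] by auto
    then show ?thesis
      using that by (metis matrix_mul_assoc matrix_mul_lid)
  qed
  define P where "P = transpose A ** A"
  have "inj ((*v) P)"
  proof (rule injI)
    fix u v assume "P *v u = P *v v"
    then have "P *v (u - v) = 0"
      by (simp add: matrix_vector_mult_diff_distrib)
    moreover have "(u - v) \<bullet> (P *v (u - v)) = (A *v (u - v)) \<bullet> (A *v (u - v))"
      by (simp add: P_def matrix_vector_inner_transpose matrix_vector_mul_assoc)
    ultimately have "A *v (u - v) = 0"
      by simp
    then have "A *v u = A *v v"
      by (simp add: matrix_vector_mult_diff_distrib)
    with inj show "u = v"
      by (simp add: inj_eq)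
  qed
  then obtain R where R: "R ** P = mat 1"
    using matrix_left_invertible_injective[of P] by auto
  then have R': "P ** R = mat 1"
    using matrix_left_right_inverse by blast
  have tP: "transpose P = P"
    by (simp add: P_def matrix_transpose_mul)
  have tR: "transpose R = R"
    by (metis R R' matrix_mul_assoc matrix_mul_lid matrix_mul_rid matrix_transpose_mul tP transpose_mat)
  define X where "X = R ** transpose A"
  have XA: "X ** A = mat 1"
    using R by (simp add: X_def P_def matrix_mul_assoc)
  have sym: "transpose (A ** X) = A ** X"
    by (simp add: X_def matrix_transpose_mul tR matrix_mul_assoc)
  have "pinv A = X"
    unfolding pinv_def
  proof (rule the_equality)
    show "A ** X ** A = A \<and> X ** A ** X = X \<and>
          transpose (A ** X) = A ** X \<and> transpose (X ** A) = X ** A"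
      using sym XA by (simp add: matrix_mul_assoc[symmetric] transpose_mat)
  next
    fix Y
    assume Y: "A ** Y ** A = A \<and> Y ** A ** Y = Y \<and>
               transpose (A ** Y) = A ** Y \<and> transpose (Y ** A) = Y ** A"
    \<comment> \<open>\<open>A ** X\<close> and \<open>A ** Y\<close> are both symmetric, so their
      products in the two orders are transposes of each other. One order collapses to
      \<open>A ** Y\<close>, the other to \<open>A ** X\<close>.\<close>
    have "A ** Y = A ** X ** A ** Y"
      using XA by (simp add: matrix_mul_assoc[symmetric])
    also have "\<dots> = transpose (A ** Y ** A ** X)"
      using Y sym by (metis matrix_mul_assoc matrix_transpose_mul)
    also have "\<dots> = A ** X"
      using Y sym by simp
    finally show "Y = X"
      by (rule cancel)
  qed
  then show ?thesis
    using XA by (simp add: matrix_mul_assoc[symmetric])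
qed

section \<open>Extreme singular values as bounds on the Rayleigh quotient\<close>

text \<open>The discriminant argument behind the Cauchy--Schwarz inequality, run along the line through
  \<open>v\<close> in direction \<open>f v\<close>.\<close>

lemma self_adjoint_psd_kernel:
  fixes f :: "'a::real_inner \<Rightarrow> 'a"
  assumes "linear f"
    and sym: "\<And>u v. f u \<bullet> v = u \<bullet> f v"
    and psd: "\<And>u. u \<bullet> f u \<ge> 0"
    and v: "v \<bullet> f v = 0"
  shows "f v = 0"
proof (rule ccontr)
  interpret linear f by fact
  assume "f v \<noteq> 0"
  define a where "a = f v \<bullet> f v"
  define c where "c = f v \<bullet> f (f v)"
  have a: "a > 0" and c: "c \<ge> 0"
    using \<open>f v \<noteq> 0\<close> psd by (simp_all add: a_def c_def)
  \<comment> \<open>Along this line the form equals \<open>t * (2 * a + t * c)\<close>. The chosen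
    \<open>t\<close> is negative but has \<open>t * c \<ge> - a\<close>, so the second factor stays
    positive; the \<open>+ 1\<close> covers \<open>c = 0\<close>.\<close>
  define t where "t = - a / (c + 1)"
  have "0 \<le> (v + t *\<^sub>R f v) \<bullet> f (v + t *\<^sub>R f v)"
    by (rule psd)
  also have "\<dots> = t * (2 * a + t * c)"
    using v sym[of v "f v"]
    by (simp add: add scale a_def c_def inner_simps power2_eq_square algebra_simps)
  also have "\<dots> < 0"
  proof (rule mult_neg_pos)
    show "t < 0"
      using a c by (simp add: t_def divide_neg_pos)
    have "a * (c / (c + 1)) \<le> a * 1"
      using a c by (intro mult_left_mono) (auto simp: divide_simps)
    then show "2 * a + t * c > 0"
      using a by (simp add: t_def)
  qed
  finally show False
    by simp
qed

text \<open>Eigenvectors of a symmetric matrix for distinct eigenvalues are orthogonal, hence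
  independent, and the dimension bounds their number. Finiteness is what gives \<open>Max\<close>
  and \<open>Min\<close> in \<open>sigma_max\<close> and \<open>sigma_min\<close> their
  meaning.\<close>

lemma finite_singular_values:
  fixes A :: "real^'n^'m"
  shows "finite (singular_values A)"
proof -
  define P where "P = transpose A ** A"
  define L where "L = {l. \<exists>v. v \<noteq> 0 \<and> P *v v = l *\<^sub>R v}"
  have sym: "(P *v u) \<bullet> v = u \<bullet> (P *v v)" for u v
    by (simp add: P_def matrix_vector_inner_transpose matrix_transpose_mul)
  have "\<forall>l\<in>L. \<exists>v. v \<noteq> 0 \<and> P *v v = l *\<^sub>R v"
    by (simp add: L_def)
  then obtain e where "\<forall>l\<in>L. e l \<noteq> 0 \<and> P *v e l = l *\<^sub>R e l"
    by (rule bchoice[THEN exE])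
  then have e: "e l \<noteq> 0" "P *v e l = l *\<^sub>R e l" if "l \<in> L" for l
    using that by auto
  have orth: "e l \<bullet> e k = 0" if "l \<in> L" "k \<in> L" "l \<noteq> k" for l k
    using sym[of "e l" "e k"] e[OF that(1)] e[OF that(2)] that(3) by simp
  have "inj_on e L"
    using orth e by (metis inj_onI inner_eq_zero_iff)
  moreover have "independent (e ` L)"
    using orth e by (intro pairwise_orthogonal_independent)
      (auto simp: pairwise_def orthogonal_def)
  ultimately have "finite L"
    using independent_imp_finite finite_image_iff by blast
  moreover have "singular_values A = sqrt ` L"
    by (auto simp: singular_values_def L_def P_def)
  ultimately show ?thesis
    by simp
qed

text \<open>Since \<open>sqrt\<close> of a negative real is negative in HOL, the claim rests on the
  eigenvalue itself: pairing the eigenvector equation with \<open>v\<close> gives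
  \<open>l * (v \<bullet> v) = (A *v v) \<bullet> (A *v v)\<close>.\<close>

lemma singular_values_nonneg:
  assumes "s \<in> singular_values A"
  shows "s \<ge> 0"
proof -
  obtain l v where s: "s = sqrt l" and v: "v \<noteq> 0" "(transpose A ** A) *v v = l *\<^sub>R v"
    using assms by (auto simp: singular_values_def)
  have "l * (v \<bullet> v) = (A *v v) \<bullet> (A *v v)"
    using arg_cong[OF v(2), of "\<lambda>w. v \<bullet> w"]
    by (simp add: matrix_vector_inner_transpose matrix_vector_mul_assoc)
  then have "l * (v \<bullet> v) \<ge> 0"
    by simp
  then have "l \<ge> 0"
    using v(1) by (metis inner_gt_zero_iff zero_le_mult_iff not_less)
  then show ?thesis
    by (simp add: s)
qed

text \<open>At an extremal unit vector the form of \<open>transpose A ** A - l I\<close> is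
  semidefinite and vanishes at \<open>v\<close>, so \<open>v\<close> lies in its kernel and is an
  eigenvector. A maximum is treated by negating the form.\<close>

lemma singular_value_of_extremal:
  fixes A :: "real^'n^'m"
  assumes v: "norm v = 1"
    and ext: "(\<forall>u. (norm (A *v v))\<^sup>2 * (norm u)\<^sup>2 \<le> (norm (A *v u))\<^sup>2)
            \<or> (\<forall>u. (norm (A *v u))\<^sup>2 \<le> (norm (A *v v))\<^sup>2 * (norm u)\<^sup>2)"
  shows "norm (A *v v) \<in> singular_values A"
proof -
  define l where "l = (norm (A *v v))\<^sup>2"
  define f where "f u = (transpose A ** A) *v u - l *\<^sub>R u" for u
  have quad: "u \<bullet> f u = (norm (A *v u))\<^sup>2 - l * (norm u)\<^sup>2" for u
    by (simp add: f_def inner_simps power2_norm_eq_inner matrix_vector_inner_transpose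
        matrix_vector_mul_assoc)
  have lin: "linear f"
    unfolding f_def by (intro linear_compose_sub matrix_vector_mul_linear linear_scaleR)
  have sym: "f u \<bullet> w = u \<bullet> f w" for u w
    by (simp add: f_def inner_simps matrix_vector_inner_transpose matrix_transpose_mul)
  have v0: "v \<bullet> f v = 0"
    using v by (simp add: quad l_def)
  from ext have "f v = 0"
  proof
    assume "\<forall>u. (norm (A *v v))\<^sup>2 * (norm u)\<^sup>2 \<le> (norm (A *v u))\<^sup>2"
    then show ?thesis
      by (intro self_adjoint_psd_kernel[OF lin sym _ v0]) (simp add: quad l_def)
  next
    assume "\<forall>u. (norm (A *v u))\<^sup>2 \<le> (norm (A *v v))\<^sup>2 * (norm u)\<^sup>2"
    then have "- f v = 0"
      using sym v0 by (intro self_adjoint_psd_kernel[OF linear_compose_neg[OF lin]])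
        (simp_all add: quad l_def)
    then show ?thesis
      by simp
  qed
  then have "(transpose A ** A) *v v = l *\<^sub>R v"
    by (simp add: f_def)
  moreover have "v \<noteq> 0" "norm (A *v v) = sqrt l"
    using v by (auto simp: l_def)
  ultimately show ?thesis
    unfolding singular_values_def by blast
qed

lemma norm_matrix_vector_normalized:
  fixes A :: "real^'n^'m"
  shows "(norm (A *v u))\<^sup>2 = (norm (A *v (u /\<^sub>R norm u)))\<^sup>2 * (norm u)\<^sup>2"
  by (cases "u = 0") (simp_all add: matrix_vector_mult_scaleR power_mult_distrib divide_simps)

lemma unit_sphere_extrema:
  fixes A :: "real^'n^'m"
  obtains v w where "norm v = 1" "norm w = 1"
    "\<And>u. (norm (A *v v))\<^sup>2 * (norm u)\<^sup>2 \<le> (norm (A *v u))\<^sup>2"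
    "\<And>u. (norm (A *v u))\<^sup>2 \<le> (norm (A *v w))\<^sup>2 * (norm u)\<^sup>2"
proof -
  have comp: "compact (sphere (0::real^'n) 1)" and ne: "sphere (0::real^'n) 1 \<noteq> {}"
    by simp_all
  have cont: "continuous_on (sphere 0 1) (\<lambda>u. (norm (A *v u))\<^sup>2)"
    by (intro continuous_intros)
  obtain v where v: "norm v = 1" "\<And>u. norm u = 1 \<Longrightarrow> (norm (A *v v))\<^sup>2 \<le> (norm (A *v u))\<^sup>2"
    using continuous_attains_inf[OF comp ne cont] by auto
  obtain w where w: "norm w = 1" "\<And>u. norm u = 1 \<Longrightarrow> (norm (A *v u))\<^sup>2 \<le> (norm (A *v w))\<^sup>2"
    using continuous_attains_sup[OF comp ne cont] by auto
  show thesis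
  proof
    show "norm v = 1" "norm w = 1" by fact+
    fix u :: "real^'n"
    show "(norm (A *v v))\<^sup>2 * (norm u)\<^sup>2 \<le> (norm (A *v u))\<^sup>2"
    proof (cases "u = 0")
      case False
      then show ?thesis
        using mult_right_mono[OF v(2)[of "u /\<^sub>R norm u"], of "(norm u)\<^sup>2"]
        by (simp flip: norm_matrix_vector_normalized)
    qed simp
    show "(norm (A *v u))\<^sup>2 \<le> (norm (A *v w))\<^sup>2 * (norm u)\<^sup>2"
    proof (cases "u = 0")
      case False
      then show ?thesis
        using mult_right_mono[OF w(2)[of "u /\<^sub>R norm u"], of "(norm u)\<^sup>2"]
        by (simp flip: norm_matrix_vector_normalized)
    qed simp
  qed
qed

lemma sigma_max_bound:
  fixes A :: "real^'n^'m"
  shows "(norm (A *v u))\<^sup>2 \<le> (sigma_max A)\<^sup>2 * (norm u)\<^sup>2"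
proof -
  obtain w where w: "norm w = 1" "\<And>u. (norm (A *v u))\<^sup>2 \<le> (norm (A *v w))\<^sup>2 * (norm u)\<^sup>2"
    using unit_sphere_extrema[of A] by metis
  have "norm (A *v w) \<in> singular_values A"
    using w by (intro singular_value_of_extremal) auto
  then have "norm (A *v w) \<le> sigma_max A"
    unfolding sigma_max_def by (simp add: finite_singular_values)
  then show ?thesis
    by (intro order_trans[OF w(2)] mult_right_mono power_mono) auto
qed

text \<open>Full column rank keeps the minimum of \<open>norm (A *v v)\<close> over the unit sphere
  away from 0, so this minimum is among the values over which \<open>sigma_min\<close> is
  taken.\<close>

lemma sigma_min_bound:
  fixes A :: "real^'n^'m"
  assumes "rank A = CARD('n)"
  shows "(sigma_min A)\<^sup>2 * (norm u)\<^sup>2 \<le> (norm (A *v u))\<^sup>2"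
proof -
  obtain v where v: "norm v = 1" "\<And>u. (norm (A *v v))\<^sup>2 * (norm u)\<^sup>2 \<le> (norm (A *v u))\<^sup>2"
    using unit_sphere_extrema[of A] by metis
  have "inj ((*v) A)"
    using assms by (simp add: full_rank_injective)
  then have "A *v v \<noteq> 0"
    using v(1) by (metis injD matrix_vector_mult_0_right norm_zero zero_neq_one)
  then have mem: "norm (A *v v) \<in> singular_values A - {0}"
    using singular_value_of_extremal[OF v(1)] v(2) by auto
  then have "sigma_min A \<le> norm (A *v v)"
    unfolding sigma_min_def by (simp add: finite_singular_values)
  moreover have "sigma_min A \<in> singular_values A - {0}"
    unfolding sigma_min_def using mem by (intro Min_in) (auto simp: finite_singular_values)
  then have "sigma_min A \<ge> 0"
    using singular_values_nonneg by auto
  ultimately show ?thesis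
    by (intro order_trans[OF _ v(2)] mult_right_mono power_mono) auto
qed

section \<open>Independence of the current state from the fresh sample\<close>

text \<open>The conclusion expresses the independence of \<open>H k\<close> and \<open>Q k\<close> through their joint distribution,
  as \<open>indep_var\<close> requires both variables to take values in the same type.\<close>

lemma (in prob_space) iterated_joint_distr:
  fixes H :: "nat \<Rightarrow> 'a \<Rightarrow> 'h" and Q :: "nat \<Rightarrow> 'a \<Rightarrow> 'q"
  assumes indep: "indep_vars (\<lambda>_. K) Q {1..}"
    and F [measurable]: "F \<in> measurable (N \<Otimes>\<^sub>M K) N"
    and c: "c \<in> space N"
    and H1: "\<And>\<xi>. \<xi> \<in> space M \<Longrightarrow> H 1 \<xi> = c"
    and step: "\<And>k \<xi>. k \<ge> 1 \<Longrightarrow> \<xi> \<in> space M \<Longrightarrow> H (k + 1) \<xi> = F (H k \<xi>, Q k \<xi>)"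
    and k: "k \<ge> (1::nat)"
  shows "random_variable N (H k)" and "random_variable K (Q k)"
    and "distr M N (H k) \<Otimes>\<^sub>M distr M K (Q k) = distr M (N \<Otimes>\<^sub>M K) (\<lambda>\<xi>. (H k \<xi>, Q k \<xi>))"
proof -
  \<comment> \<open>The state at time \<open>k\<close> is a measurable function of the samples
    \<open>1, ..., k - 1\<close> alone. At \<open>k = 1\<close> the index set is empty and the
    function is constant.\<close>
  have "\<exists>\<Phi>. \<Phi> \<in> measurable (Pi\<^sub>M {1..<k} (\<lambda>_. K)) N
           \<and> (\<forall>\<xi>\<in>space M. H k \<xi> = \<Phi> (\<lambda>i\<in>{1..<k}. Q i \<xi>))"
    using k
  proof (induction k rule: dec_induct)
    case base
    show ?case
      using c H1 by (intro exI[of _ "\<lambda>_. c"]) auto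
  next
    case (step k)
    then obtain \<Phi> where [measurable]: "\<Phi> \<in> measurable (Pi\<^sub>M {1..<k} (\<lambda>_. K)) N"
      and \<Phi>: "\<And>\<xi>. \<xi> \<in> space M \<Longrightarrow> H k \<xi> = \<Phi> (\<lambda>i\<in>{1..<k}. Q i \<xi>)"
      by blast
    have [measurable]:
      "(\<lambda>z. restrict z {1..<k}) \<in> measurable (Pi\<^sub>M {1..<Suc k} (\<lambda>_. K)) (Pi\<^sub>M {1..<k} (\<lambda>_. K))"
      "(\<lambda>z. z k) \<in> measurable (Pi\<^sub>M {1..<Suc k} (\<lambda>_. K)) K"
      using step.hyps by (auto intro!: measurable_restrict_subset measurable_component_singleton)
    show ?case
    proof (intro exI conjI ballI)
      show "(\<lambda>z. F (\<Phi> (restrict z {1..<k}), z k)) \<in> measurable (Pi\<^sub>M {1..<Suc k} (\<lambda>_. K)) N"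
        by measurable
      fix \<xi> assume "\<xi> \<in> space M"
      moreover have "{1..<Suc k} \<inter> {1..<k} = {1..<k}"
        by auto
      ultimately show "H (Suc k) \<xi> = F (\<Phi> (restrict (\<lambda>i\<in>{1..<Suc k}. Q i \<xi>) {1..<k}),
          (\<lambda>i\<in>{1..<Suc k}. Q i \<xi>) k)"
        using assms(5)[of k \<xi>] \<Phi> step.hyps by simp
    qed
  qed
  then obtain \<Phi> where [measurable]: "\<Phi> \<in> measurable (Pi\<^sub>M {1..<k} (\<lambda>_. K)) N"
    and H: "\<And>\<xi>. \<xi> \<in> space M \<Longrightarrow> H k \<xi> = \<Phi> (\<lambda>i\<in>{1..<k}. Q i \<xi>)"
    by blast
  \<comment> \<open>Past and present become subfamilies over disjoint index sets, hence independent.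
    Their joint law is then pushed forward by \<Phi> in the first component and by evaluation at
    \<open>k\<close> in the second.\<close>
  define X Y where "X \<xi> = (\<lambda>i\<in>{1..<k}. Q i \<xi>)" and "Y \<xi> = (\<lambda>i\<in>{k}. Q i \<xi>)" for \<xi>
  let ?P = "Pi\<^sub>M {1..<k} (\<lambda>_. K)" and ?R = "Pi\<^sub>M {k} (\<lambda>_. K)"
  have "indep_var ?P X ?R Y"
    unfolding X_def Y_def using k by (intro indep_var_restrict[OF indep]) auto
  then have X [measurable]: "random_variable ?P X" and Y [measurable]: "random_variable ?R Y"
    and joint: "distr M ?P X \<Otimes>\<^sub>M distr M ?R Y = distr M (?P \<Otimes>\<^sub>M ?R) (\<lambda>\<xi>. (X \<xi>, Y \<xi>))"
    by (auto simp: indep_var_distribution_eq)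
  have proj [measurable]: "(\<lambda>z. z k) \<in> measurable ?R K"
    by (rule measurable_component_singleton) simp
  have H': "H k \<xi> = \<Phi> (X \<xi>)" if "\<xi> \<in> space M" for \<xi>
    using H[OF that] by (simp add: X_def)
  have Q': "Q k \<xi> = Y \<xi> k" for \<xi>
    by (simp add: Y_def)
  have "random_variable N (\<lambda>\<xi>. \<Phi> (X \<xi>))"
    by measurable
  then show H_meas: "random_variable N (H k)"
    using H' by (simp cong: measurable_cong)
  have "random_variable K (\<lambda>\<xi>. Y \<xi> k)"
    by measurable
  then show Q_meas: "random_variable K (Q k)"
    by (simp add: Q' cong: measurable_cong)
  interpret Y: prob_space "distr (distr M ?R Y) K (\<lambda>z. z k)"
    by (intro prob_space.prob_space_distr prob_space_distr) simp_all
  have "distr M N (H k) \<Otimes>\<^sub>M distr M K (Q k)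
      = distr (distr M ?P X) N \<Phi> \<Otimes>\<^sub>M distr (distr M ?R Y) K (\<lambda>z. z k)"
  proof -
    have "distr (distr M ?P X) N \<Phi> = distr M N (\<Phi> \<circ> X)"
      by (rule distr_distr) measurable
    also have "\<dots> = distr M N (H k)"
      by (intro distr_cong) (simp_all add: H')
    finally have 1: "distr (distr M ?P X) N \<Phi> = distr M N (H k)" .
    have "distr (distr M ?R Y) K (\<lambda>z. z k) = distr M K ((\<lambda>z. z k) \<circ> Y)"
      by (rule distr_distr) measurable
    also have "\<dots> = distr M K (Q k)"
      by (intro distr_cong) (simp_all add: Q')
    finally have 2: "distr (distr M ?R Y) K (\<lambda>z. z k) = distr M K (Q k)" .
    show ?thesis
      unfolding 1 2 ..
  qed
  also have "\<dots> = distr (distr M (?P \<Otimes>\<^sub>M ?R) (\<lambda>\<xi>. (X \<xi>, Y \<xi>))) (N \<Otimes>\<^sub>M K) (\<lambda>(u, z). (\<Phi> u, z k))"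
    unfolding joint[symmetric]
    by (rule pair_measure_distr, measurable) (rule Y.sigma_finite_measure_axioms)
  also have "\<dots> = distr M (N \<Otimes>\<^sub>M K) (\<lambda>\<xi>. (\<Phi> (X \<xi>), Y \<xi> k))"
    by (subst distr_distr, measurable) (simp add: o_def)
  also have "\<dots> = distr M (N \<Otimes>\<^sub>M K) (\<lambda>\<xi>. (H k \<xi>, Q k \<xi>))"
    by (intro distr_cong) (simp_all add: H' Q')
  finally show "distr M N (H k) \<Otimes>\<^sub>M distr M K (Q k)
      = distr M (N \<Otimes>\<^sub>M K) (\<lambda>\<xi>. (H k \<xi>, Q k \<xi>))" .
qed

text \<open>Tonelli allows \<open>Y\<close> to be averaged first with \<open>H\<close> frozen. The
  estimate is made for nonnegative integrals, and the finite bound from \<open>g\<close> carries it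
  back to the Bochner expectation.\<close>

lemma (in prob_space) expectation_joint_distr_le:
  assumes H [measurable]: "random_variable N H" and Y [measurable]: "random_variable K Y"
    and joint: "distr M N H \<Otimes>\<^sub>M distr M K Y = distr M (N \<Otimes>\<^sub>M K) (\<lambda>\<xi>. (H \<xi>, Y \<xi>))"
    and f [measurable]: "f \<in> borel_measurable (N \<Otimes>\<^sub>M K)"
    and f_nonneg: "\<And>z. f z \<ge> (0::real)"
    and g [measurable]: "g \<in> borel_measurable N"
    and g_int: "integrable M (\<lambda>\<xi>. g (H \<xi>))"
    and inner_int: "\<And>h. h \<in> space N \<Longrightarrow> integrable (distr M K Y) (\<lambda>y. f (h, y))"
    and inner_le: "\<And>h. h \<in> space N \<Longrightarrow> (\<integral>y. f (h, y) \<partial>distr M K Y) \<le> g h"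
  shows "expectation (\<lambda>\<xi>. f (H \<xi>, Y \<xi>)) \<le> expectation (\<lambda>\<xi>. g (H \<xi>))"
proof -
  interpret Y: prob_space "distr M K Y"
    by (rule prob_space_distr) simp
  have g_nonneg: "g h \<ge> 0" if "h \<in> space N" for h
    using f_nonneg by (intro order_trans[OF Bochner_Integration.integral_nonneg inner_le[OF that]]) auto
  have g_H: "g (H \<xi>) \<ge> 0" if "\<xi> \<in> space M" for \<xi>
    using g_nonneg that measurable_space[OF H] by blast
  have "(\<integral>\<^sup>+\<xi>. f (H \<xi>, Y \<xi>) \<partial>M) = (\<integral>\<^sup>+z. f z \<partial>distr M (N \<Otimes>\<^sub>M K) (\<lambda>\<xi>. (H \<xi>, Y \<xi>)))"
    by (subst nn_integral_distr) auto
  also have "\<dots> = (\<integral>\<^sup>+h. \<integral>\<^sup>+y. f (h, y) \<partial>distr M K Y \<partial>distr M N H)"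
    unfolding joint[symmetric] by (subst Y.nn_integral_fst[symmetric]) auto
  also have "\<dots> \<le> (\<integral>\<^sup>+h. g h \<partial>distr M N H)"
    using inner_int inner_le f_nonneg
    by (intro nn_integral_mono) (simp add: nn_integral_eq_integral ennreal_leI)
  also have "\<dots> = (\<integral>\<^sup>+\<xi>. g (H \<xi>) \<partial>M)"
    by (subst nn_integral_distr) auto
  also have "\<dots> = ennreal (expectation (\<lambda>\<xi>. g (H \<xi>)))"
    using g_H by (intro nn_integral_eq_integral g_int) auto
  finally have le: "(\<integral>\<^sup>+\<xi>. f (H \<xi>, Y \<xi>) \<partial>M) \<le> ennreal (expectation (\<lambda>\<xi>. g (H \<xi>)))" .
  have "expectation (\<lambda>\<xi>. f (H \<xi>, Y \<xi>)) = enn2real (\<integral>\<^sup>+\<xi>. f (H \<xi>, Y \<xi>) \<partial>M)"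
    by (rule integral_eq_nn_integral) (auto simp: f_nonneg)
  also have "\<dots> \<le> enn2real (ennreal (expectation (\<lambda>\<xi>. g (H \<xi>))))"
    by (rule enn2real_mono[OF le]) simp
  also have "\<dots> = expectation (\<lambda>\<xi>. g (H \<xi>))"
    by (rule enn2real_ennreal) (intro integral_nonneg_AE AE_I2 g_H)
  finally show ?thesis .
qed

section \<open>The scalar two-term recursion\<close>

text \<open>For \<open>\<gamma>2 = 0\<close> the root formula would give the maximum of \<gamma>1
  and 0, whereas \<open>q = \<gamma>1\<close> may be negative; hence the separate case.\<close>

lemma two_term_recursion_bound:
  fixes F :: "nat \<Rightarrow> real"
  assumes nonneg: "\<And>k. F k \<ge> 0"
    and start: "F 1 = F 0"
    and rec: "\<And>k. F (k + 2) \<le> \<gamma>1 * F (k + 1) + \<gamma>2 * F k"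
    and \<gamma>2: "\<gamma>2 \<ge> 0"
    and sum: "\<gamma>1 + \<gamma>2 < 1"
    and q: "q = (if \<gamma>2 > 0 then (\<gamma>1 + sqrt (\<gamma>1\<^sup>2 + 4 * \<gamma>2)) / 2 else \<gamma>1)"
  shows "F (k + 1) \<le> q ^ k * (1 + (q - \<gamma>1)) * F 0"
    and "q - \<gamma>1 \<ge> 0" and "\<gamma>1 + \<gamma>2 \<le> q" and "q < 1"
proof -
  have "F (k + 1) \<le> q ^ k * (1 + (q - \<gamma>1)) * F 0
      \<and> q - \<gamma>1 \<ge> 0 \<and> \<gamma>1 + \<gamma>2 \<le> q \<and> q < 1"
  proof (cases "\<gamma>2 > 0")
    case True
    define d where "d = sqrt (\<gamma>1\<^sup>2 + 4 * \<gamma>2)"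
    have q': "q = (\<gamma>1 + d) / 2"
      using q True by (simp add: d_def)
    have d2: "d\<^sup>2 = \<gamma>1\<^sup>2 + 4 * \<gamma>2"
      using True by (simp add: d_def)
    have "\<bar>\<gamma>1\<bar> < d"
      unfolding d_def using True by (intro real_less_rsqrt) simp
    then have q_pos: "q > 0" and \<tau>: "q - \<gamma>1 \<ge> 0"
      by (auto simp: q')
    \<comment> \<open>After squaring this reads
      \<open>\<gamma>2 * (\<gamma>1 + \<gamma>2) \<le> \<gamma>2\<close>. Likewise the bound
      \<open>d < 2 - \<gamma>1\<close> below squares to
      \<open>\<gamma>1 + \<gamma>2 < 1\<close>.\<close>
    have "\<gamma>1 + 2 * \<gamma>2 \<le> d"
      unfolding d_def
    proof (rule real_le_rsqrt)
      have "\<gamma>2 * (\<gamma>1 + \<gamma>2) \<le> \<gamma>2 * 1"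
        using sum True by (intro mult_left_mono) auto
      then show "(\<gamma>1 + 2 * \<gamma>2)\<^sup>2 \<le> \<gamma>1\<^sup>2 + 4 * \<gamma>2"
        by (simp add: power2_eq_square algebra_simps)
    qed
    then have lower: "\<gamma>1 + \<gamma>2 \<le> q"
      by (simp add: q')
    have "d < 2 - \<gamma>1"
      unfolding d_def using sum True
      by (intro real_less_lsqrt) (auto simp: power2_eq_square algebra_simps)
    then have upper: "q < 1"
      by (simp add: q')
    have root: "q * (q - \<gamma>1) = \<gamma>2"
      using d2 by (simp add: q' field_simps power2_eq_square)
    \<comment> \<open>The factor \<open>1 + (q - \<gamma>1)\<close> is the value at
      \<open>k = 0\<close>, where \<open>F 1 = F 0\<close>.\<close>
    have "F (k + 1) + (q - \<gamma>1) * F k \<le> q ^ k * (1 + (q - \<gamma>1)) * F 0"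
    proof (induction k)
      case 0
      show ?case
        using start by (simp add: algebra_simps)
    next
      case (Suc k)
      have "F (Suc k + 1) + (q - \<gamma>1) * F (Suc k) \<le> q * F (k + 1) + \<gamma>2 * F k"
        using rec[of k] by (simp add: algebra_simps)
      also have "\<dots> = q * (F (k + 1) + (q - \<gamma>1) * F k)"
        by (simp add: root[symmetric] algebra_simps)
      also have "\<dots> \<le> q * (q ^ k * (1 + (q - \<gamma>1)) * F 0)"
        using Suc q_pos by (intro mult_left_mono) auto
      finally show ?case
        by (simp add: mult_ac)
    qed
    moreover have "(q - \<gamma>1) * F k \<ge> 0"
      using \<tau> nonneg by simp
    ultimately show ?thesis
      using \<tau> lower upper by linarith
  next
    case False
    then have \<gamma>2_0: "\<gamma>2 = 0" and q': "q = \<gamma>1"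
      using \<gamma>2 q by auto
    have rec': "F (k + 2) \<le> q * F (k + 1)" for k
      using rec[of k] by (simp add: \<gamma>2_0 q')
    have "F (k + 1) \<le> q ^ k * F 0"
    proof (cases "q \<ge> 0")
      case True
      show ?thesis
      proof (induction k)
        case (Suc k)
        have "F (Suc k + 1) \<le> q * F (k + 1)"
          using rec'[of k] by simp
        also have "\<dots> \<le> q * (q ^ k * F 0)"
          using Suc True by (rule mult_left_mono)
        finally show ?case
          by (simp add: mult_ac)
      qed (use start in simp)
    next
      case False
      \<comment> \<open>A negative factor forces the nonnegative sequence to vanish.\<close>
      have zero: "F (k + 1) = 0" for k
      proof -
        have "q * F (k + 1) \<ge> 0"
          using rec'[of k] nonneg[of "k + 2"] by linarith
        then show ?thesis
          using False nonneg[of "k + 1"] by (simp add: zero_le_mult_iff)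
      qed
      then have "F 0 = 0"
        using start zero[of 0] by simp
      then show ?thesis
        using zero[of k] by simp
    qed
    then show ?thesis
      using sum by (simp add: \<gamma>2_0 q')
  qed
  then show "F (k + 1) \<le> q ^ k * (1 + (q - \<gamma>1)) * F 0"
    and "q - \<gamma>1 \<ge> 0" and "\<gamma>1 + \<gamma>2 \<le> q" and "q < 1"
    by auto
qed

section \<open>Averaging one step over the fresh sample\<close>

lemma transpose_mult_transp: "transpose (mult_transp p U V) = mult_transp p V U"
  by (simp add: mult_transp_def transpose_def vec_eq_iff mult.commute)

lemma sketch_gram_eq: "sketch_gram A z = transpose (sketch A z) ** sketch A z"
  by (simp add: sketch_gram_def sketch_def matrix_transpose_mul transpose_mult_transp
      matrix_mul_assoc split: prod.splits)

text \<open>Bounded linearity in the matrix lets the expectation pass inside the form.\<close>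

lemma bounded_linear_quadratic_form:
  "bounded_linear (\<lambda>X::real^'n^'m. u \<bullet> (X *v v))"
  unfolding linear_conv_bounded_linear[symmetric]
  by (intro linearI)
    (simp_all add: matrix_vector_mult_add_rdistrib inner_add_right flip: scaleR_matrix_vector_assoc)

lemma norm_sq_add_scaleR:
  fixes x y :: "'a::real_inner"
  shows "(norm (x + c *\<^sub>R y))\<^sup>2 = (norm x)\<^sup>2 + 2 * c * (x \<bullet> y) + c\<^sup>2 * (norm y)\<^sup>2"
  unfolding power2_norm_eq_inner
  by (simp add: inner_add_left inner_add_right inner_commute power2_eq_square algebra_simps)

lemma borel_measurable_matrix_vector_mult:
  fixes f :: "'a \<Rightarrow> real^'n^'m"
  assumes "f \<in> borel_measurable M" "g \<in> borel_measurable M"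
  shows "(\<lambda>x. f x *v g x) \<in> borel_measurable M"
  using assms
  by (rule borel_measurable_continuous_Pair)
    (auto simp: matrix_vector_mult_def intro!: continuous_intros)

text \<open>Expanding the square leaves one term linear in \<open>G z\<close> and one linear in its
  Gram matrix, so the two mean matrices determine the result.\<close>

lemma (in prob_space) expectation_norm_sq_random_matrix:
  fixes G :: "'a \<Rightarrow> real^'m^'n"
  assumes G: "integrable M G"
    and gram: "integrable M (\<lambda>z. transpose (G z) ** G z)"
  shows "integrable M (\<lambda>z. (norm (a - \<alpha> *\<^sub>R (G z *v w)))\<^sup>2)"
    and "expectation (\<lambda>z. (norm (a - \<alpha> *\<^sub>R (G z *v w)))\<^sup>2)
         = (norm a)\<^sup>2 - 2 * \<alpha> * (a \<bullet> (expectation G *v w))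
           + \<alpha>\<^sup>2 * (w \<bullet> (expectation (\<lambda>z. transpose (G z) ** G z) *v w))"
proof -
  have expand: "(norm (a - \<alpha> *\<^sub>R (G z *v w)))\<^sup>2
      = (norm a)\<^sup>2 - 2 * \<alpha> * (a \<bullet> (G z *v w))
        + \<alpha>\<^sup>2 * (w \<bullet> ((transpose (G z) ** G z) *v w))" for z
  proof -
    have "w \<bullet> ((transpose (G z) ** G z) *v w) = (G z *v w) \<bullet> (G z *v w)"
      by (simp add: matrix_vector_inner_transpose matrix_vector_mul_assoc)
    then show ?thesis
      using norm_sq_add_scaleR[of a "- \<alpha>" "G z *v w"] by (simp add: power2_norm_eq_inner)
  qed
  note bl = bounded_linear_quadratic_form
  have [simp]: "integrable M (\<lambda>z. a \<bullet> (G z *v w))"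
    "integrable M (\<lambda>z. w \<bullet> ((transpose (G z) ** G z) *v w))"
    using integrable_bounded_linear[OF bl G] integrable_bounded_linear[OF bl gram] by auto
  show "integrable M (\<lambda>z. (norm (a - \<alpha> *\<^sub>R (G z *v w)))\<^sup>2)"
    unfolding expand by simp
  show "expectation (\<lambda>z. (norm (a - \<alpha> *\<^sub>R (G z *v w)))\<^sup>2)
         = (norm a)\<^sup>2 - 2 * \<alpha> * (a \<bullet> (expectation G *v w))
           + \<alpha>\<^sup>2 * (w \<bullet> (expectation (\<lambda>z. transpose (G z) ** G z) *v w))"
    unfolding expand using integral_bounded_linear[OF bl G] integral_bounded_linear[OF bl gram]
    by (simp add: prob_space)
qed

lemma inner_matrix_le_spectral_norm:
  fixes W :: "real^'m^'m"
  shows "w \<bullet> (W *v w) \<le> spectral_norm W * (norm w)\<^sup>2"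
proof -
  have "w \<bullet> (W *v w) \<le> norm w * norm (W *v w)"
    by (rule norm_cauchy_schwarz)
  also have "\<dots> \<le> norm w * (spectral_norm W * norm w)"
    by (intro mult_left_mono onorm) auto
  finally show ?thesis
    by (simp add: power2_eq_square mult_ac)
qed

text \<open>The cross terms are removed by the polarization identity, applied both to \<open>u, v\<close> and to
  \<open>A u, A v\<close>, which leaves only squared norms.\<close>

lemma momentum_quadratic_bound:
  fixes A :: "real^'n^'m"
  assumes rank: "rank A = CARD('n)"
    and "\<omega> \<ge> 0" and "\<alpha> \<ge> 0" and "F2 > 0" and "\<alpha> * \<beta> * F2 \<le> 2"
  shows "(norm (u + \<omega> *\<^sub>R (u - v)))\<^sup>2
         - 2 * \<alpha> * ((u + \<omega> *\<^sub>R (u - v)) \<bullet> (((1 / F2) *\<^sub>R transpose A) *v (A *v u)))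
         + \<alpha>\<^sup>2 * (\<beta> * (norm (A *v u))\<^sup>2)
    \<le> (1 + 3 * \<omega> + 2 * \<omega>\<^sup>2 - (2 * \<alpha> + \<alpha> * \<omega> - \<alpha>\<^sup>2 * \<beta> * F2) * ((sigma_min A)\<^sup>2 / F2)) * (norm u)\<^sup>2
      + (2 * \<omega>\<^sup>2 + \<omega> + \<omega> * \<alpha> * ((sigma_max A)\<^sup>2 / F2)) * (norm v)\<^sup>2"
proof -
  define d where "d = u - v"
  define R R' P P' where "R = (norm u)\<^sup>2" and "R' = (norm v)\<^sup>2"
    and "P = (norm (A *v u))\<^sup>2" and "P' = (norm (A *v v))\<^sup>2"
  have polar: "2 * (x \<bullet> (x - y)) = (norm x)\<^sup>2 + (norm (x - y))\<^sup>2 - (norm y)\<^sup>2"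
    for x y :: "'z::real_inner"
    by (simp add: power2_norm_eq_inner inner_diff_left inner_diff_right inner_commute)
  \<comment> \<open>Parallelogram law with the square of \<open>norm (u + v)\<close>
    dropped.\<close>
  have d_le: "(norm d)\<^sup>2 \<le> 2 * R + 2 * R'"
  proof -
    have "2 * R + 2 * R' - (norm d)\<^sup>2 = (norm (u + v))\<^sup>2"
      by (simp add: d_def R_def R'_def power2_norm_eq_inner inner_diff_left inner_diff_right
          inner_add_left inner_add_right inner_commute)
    then show ?thesis
      using zero_le_power2[of "norm (u + v)"] by linarith
  qed
  have "(norm (u + \<omega> *\<^sub>R d))\<^sup>2 = R + \<omega> * (2 * (u \<bullet> d)) + \<omega>\<^sup>2 * (norm d)\<^sup>2"
    by (simp add: R_def norm_sq_add_scaleR)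
  also have "\<dots> = R + \<omega> * (R - R') + (\<omega> + \<omega>\<^sup>2) * (norm d)\<^sup>2"
    unfolding d_def polar by (simp add: R_def R'_def algebra_simps)
  also have "\<dots> \<le> R + \<omega> * (R - R') + (\<omega> + \<omega>\<^sup>2) * (2 * R + 2 * R')"
    using d_le \<open>\<omega> \<ge> 0\<close> by (intro add_left_mono mult_left_mono) auto
  finally have norm_le: "(norm (u + \<omega> *\<^sub>R d))\<^sup>2
      \<le> (1 + 3 * \<omega> + 2 * \<omega>\<^sup>2) * R + (2 * \<omega>\<^sup>2 + \<omega>) * R'"
    by (simp add: algebra_simps)
  have pull: "w \<bullet> (((1 / F2) *\<^sub>R transpose A) *v (A *v u)) = ((A *v w) \<bullet> (A *v u)) / F2" for w
    by (simp add: matrix_vector_inner_transpose flip: scaleR_matrix_vector_assoc)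
  have "2 * ((u + \<omega> *\<^sub>R d) \<bullet> (((1 / F2) *\<^sub>R transpose A) *v (A *v u)))
      = (2 * P + \<omega> * (2 * ((A *v u) \<bullet> (A *v u - A *v v)))) / F2"
    unfolding pull P_def power2_norm_eq_inner d_def
    by (simp add: matrix_vector_right_distrib matrix_vector_mult_scaleR
        matrix_vector_mult_diff_distrib inner_simps inner_commute algebra_simps add_divide_distrib)
  also have "\<dots> = (2 * P + \<omega> * (P + (norm (A *v u - A *v v))\<^sup>2 - P')) / F2"
    using polar[of "A *v u" "A *v v"] by (simp add: P_def P'_def)
  \<comment> \<open>The dropped square of \<open>A (u - v)\<close> has the favourable sign, because
    the cross term enters the step with a minus.\<close>
  also have "\<dots> \<ge> (2 * P + \<omega> * (P - P')) / F2"
    using \<open>\<omega> \<ge> 0\<close> \<open>F2 > 0\<close> by (intro divide_right_mono add_left_mono mult_left_mono) auto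
  finally have cross: "\<alpha> * ((2 * P + \<omega> * (P - P')) / F2)
      \<le> \<alpha> * (2 * ((u + \<omega> *\<^sub>R d) \<bullet> (((1 / F2) *\<^sub>R transpose A) *v (A *v u))))"
    using \<open>\<alpha> \<ge> 0\<close> by (intro mult_left_mono)
  \<comment> \<open>All \<open>P\<close> terms combine to \<open>- c * (P / F2)\<close>, so the
    lower bound on \<open>P\<close> by \<open>sigma_min\<close> helps only if
    \<open>c \<ge> 0\<close>. This is where the step size restriction enters.\<close>
  define c where "c = 2 * \<alpha> + \<alpha> * \<omega> - \<alpha>\<^sup>2 * \<beta> * F2"
  have "\<alpha> * (\<alpha> * \<beta> * F2) \<le> \<alpha> * 2"
    using assms by (intro mult_left_mono) auto
  moreover have "\<alpha> * \<omega> \<ge> 0"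
    using assms by simp
  ultimately have "c \<ge> 0"
    by (simp add: c_def power2_eq_square mult_ac)
  then have "c * ((sigma_min A)\<^sup>2 * R / F2) \<le> c * (P / F2)"
    using sigma_min_bound[OF rank, of u] \<open>F2 > 0\<close>
    by (intro mult_left_mono divide_right_mono) (auto simp: R_def P_def)
  moreover have "\<omega> * \<alpha> * (P' / F2) \<le> \<omega> * \<alpha> * ((sigma_max A)\<^sup>2 * R' / F2)"
    using sigma_max_bound[of A v] assms
    by (intro mult_left_mono divide_right_mono) (auto simp: R'_def P'_def)
  moreover have "\<alpha>\<^sup>2 * (\<beta> * P) - \<alpha> * ((2 * P + \<omega> * (P - P')) / F2)
      = \<omega> * \<alpha> * (P' / F2) - c * (P / F2)"
    using \<open>F2 > 0\<close> by (simp add: c_def field_simps)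
  ultimately have "(norm (u + \<omega> *\<^sub>R d))\<^sup>2
        - \<alpha> * (2 * ((u + \<omega> *\<^sub>R d) \<bullet> (((1 / F2) *\<^sub>R transpose A) *v (A *v u)))) + \<alpha>\<^sup>2 * (\<beta> * P)
      \<le> (1 + 3 * \<omega> + 2 * \<omega>\<^sup>2) * R + (2 * \<omega>\<^sup>2 + \<omega>) * R'
        - c * ((sigma_min A)\<^sup>2 * R / F2) + \<omega> * \<alpha> * ((sigma_max A)\<^sup>2 * R' / F2)"
    using norm_le cross by linarith
  also have "\<dots> = (1 + 3 * \<omega> + 2 * \<omega>\<^sup>2 - c * ((sigma_min A)\<^sup>2 / F2)) * R
      + (2 * \<omega>\<^sup>2 + \<omega> + \<omega> * \<alpha> * ((sigma_max A)\<^sup>2 / F2)) * R'"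
    by (simp add: distrib_right left_diff_distrib)
  finally show ?thesis
    by (simp only: c_def d_def R_def R'_def P_def mult.assoc mult.left_commute[of \<alpha> 2])
qed

section \<open>From one averaged step to the error bound for the iteration\<close>

theorem theorem4p5:
  fixes A :: "real^'n^'m" and b :: "real^'m" and x0 :: "real^'n"
    and D :: "('m, 'n) quadruple measure"
    and M :: "'w measure" and Q :: "nat \<Rightarrow> 'w \<Rightarrow> ('m, 'n) quadruple"
    and x :: "nat \<Rightarrow> 'w \<Rightarrow> real^'n"
    and \<alpha> \<omega> \<beta>1 \<gamma>1 \<gamma>2 q \<tau> :: real
  assumes full_column_rank: "rank A = CARD('n)"
    and consistent: "\<exists>z. A *v z = b"
    and D_prob: "prob_space D"
    and D_sets: "sets D = sets borel"
    and sketch_integrable: "integrable D (sketch A)"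
    and sketch_mean: "integral\<^sup>L D (sketch A) = (1 / (frobenius_norm A)\<^sup>2) *\<^sub>R transpose A"
    and gram_integrable: "integrable D (sketch_gram A)"
    and M_prob: "prob_space M"
    and Q_indep: "prob_space.indep_vars M (\<lambda>_. borel) Q {1..}"
    and Q_distr: "\<And>k. k \<ge> 1 \<Longrightarrow> distr M borel (Q k) = D"
    and x_0: "\<And>\<xi>. \<xi> \<in> space M \<Longrightarrow> x 0 \<xi> = x0"
    and x_1: "\<And>\<xi>. \<xi> \<in> space M \<Longrightarrow> x 1 \<xi> = x0"
    and x_step: "\<And>k \<xi>. k \<ge> 1 \<Longrightarrow> \<xi> \<in> space M \<Longrightarrow>
        x (k + 1) \<xi> = x k \<xi> - \<alpha> *\<^sub>R (sketch A (Q k \<xi>) *v (A *v x k \<xi> - b))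
                      + \<omega> *\<^sub>R (x k \<xi> - x (k - 1) \<xi>)"
    and error_integrable: "\<And>k. integrable M (\<lambda>\<xi>. (norm (x (k + 1) \<xi> - pinv A *v b))\<^sup>2)"
    and \<beta>1: "\<beta>1 = spectral_norm (integral\<^sup>L D (sketch_gram A))"
    and \<alpha>_pos: "0 < \<alpha>"
    and \<alpha>_less: "\<alpha> < 2 / (\<beta>1 * (frobenius_norm A)\<^sup>2)"
    and \<omega>_nonneg: "\<omega> \<ge> 0"
    and \<gamma>1: "\<gamma>1 = 1 + 3 * \<omega> + 2 * \<omega>\<^sup>2
        - (2 * \<alpha> + \<alpha> * \<omega> - \<alpha>\<^sup>2 * \<beta>1 * (frobenius_norm A)\<^sup>2)
          * ((sigma_min A)\<^sup>2 / (frobenius_norm A)\<^sup>2)"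
    and \<gamma>2: "\<gamma>2 = 2 * \<omega>\<^sup>2 + \<omega> + \<omega> * \<alpha> * ((sigma_max A)\<^sup>2 / (frobenius_norm A)\<^sup>2)"
    and \<gamma>_sum: "\<gamma>1 + \<gamma>2 < 1"
    and q: "q = (if \<omega> > 0 then (\<gamma>1 + sqrt (\<gamma>1\<^sup>2 + 4 * \<gamma>2)) / 2 else \<gamma>1)"
    and \<tau>: "\<tau> = q - \<gamma>1"
  shows "(\<forall>k. integral\<^sup>L M (\<lambda>\<xi>. (norm (x (k + 1) \<xi> - pinv A *v b))\<^sup>2)
              \<le> q ^ k * (1 + \<tau>) * (norm (x0 - pinv A *v b))\<^sup>2)
       \<and> \<tau> \<ge> 0 \<and> \<gamma>1 + \<gamma>2 \<le> q \<and> q < 1"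
proof -
  define e where "e = pinv A *v b"
  define F2 where "F2 = (frobenius_norm A)\<^sup>2"
  obtain z where "A *v z = b"
    using consistent by blast
  then have Ae: "A *v e = b"
    using pinv_full_column_rank[OF full_column_rank]
    by (metis e_def matrix_vector_mul_assoc)
  interpret D: prob_space D by (rule D_prob)
  interpret M: prob_space M by (rule M_prob)

  have "\<beta>1 \<ge> 0"
    unfolding \<beta>1 by (intro onorm_pos_le) auto
  moreover have "F2 \<ge> 0"
    by (simp add: F2_def)
  \<comment> \<open>Division by zero yields 0, so a vanishing product would force
    \<open>\<alpha> < 0\<close>.\<close>
  moreover have "\<beta>1 * F2 \<noteq> 0"
    using \<alpha>_pos \<alpha>_less unfolding F2_def by auto
  ultimately have F2_pos: "F2 > 0" and \<beta>F_pos: "\<beta>1 * F2 > 0"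
    by (auto simp: less_le)
  then have step_size: "\<alpha> * \<beta>1 * F2 \<le> 2"
    using \<alpha>_less by (simp add: F2_def pos_less_divide_eq mult.assoc)

  \<comment> \<open>Pairing the last two errors makes the second-order iteration a first-order chain
    driven by \<open>Q k\<close>, started at \<open>k = 1\<close>. The update \<open>f\<close> gives
    the new error, and \<open>g\<close> is the claimed bound on its conditional mean square.\<close>
  define H where "H k \<xi> = (x k \<xi> - e, x (k - 1) \<xi> - e)" for k \<xi>
  define f where "f = (\<lambda>(h, z). fst h + \<omega> *\<^sub>R (fst h - snd h) - \<alpha> *\<^sub>R (sketch A z *v (A *v fst h)))"
  define g where "g = (\<lambda>h::(real^'n) \<times> (real^'n). \<gamma>1 * (norm (fst h))\<^sup>2 + \<gamma>2 * (norm (snd h))\<^sup>2)"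
  have [measurable]: "sketch A \<in> borel_measurable borel"
    using borel_measurable_integrable[OF sketch_integrable] D_sets
    by (simp cong: measurable_cong_sets)
  note [measurable] = borel_measurable_matrix_vector_mult
  have f_meas [measurable]: "f \<in> borel_measurable ((borel \<Otimes>\<^sub>M borel) \<Otimes>\<^sub>M borel)"
    unfolding f_def by measurable
  have g_meas: "g \<in> borel_measurable (borel \<Otimes>\<^sub>M borel)"
    unfolding g_def by measurable
  have H_step: "x (k + 1) \<xi> - e = f (H k \<xi>, Q k \<xi>)" if "k \<ge> 1" "\<xi> \<in> space M" for k \<xi>
    using x_step[OF that]
    by (simp add: f_def H_def Ae matrix_vector_mult_diff_distrib)
  have H_update: "(\<lambda>p. (f p, fst (fst p))) \<in> (borel \<Otimes>\<^sub>M borel) \<Otimes>\<^sub>M borel \<rightarrow>\<^sub>M borel \<Otimes>\<^sub>M borel"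
    by measurable
  have H_space: "(x0 - e, x0 - e) \<in> space (borel \<Otimes>\<^sub>M borel)"
    by (simp add: space_pair_measure)
  have H_1: "H 1 \<xi> = (x0 - e, x0 - e)" if "\<xi> \<in> space M" for \<xi>
    using that x_0 x_1 by (simp add: H_def)
  have H_iter: "H (k + 1) \<xi> = (f (H k \<xi>, Q k \<xi>), fst (fst (H k \<xi>, Q k \<xi>)))"
    if "k \<ge> 1" "\<xi> \<in> space M" for k \<xi>
    using H_step[OF that] by (simp add: H_def)
  note H_Q = M.iterated_joint_distr[where H = H, OF Q_indep H_update H_space H_1 H_iter]

  have gram: "integrable D (\<lambda>z. transpose (sketch A z) ** sketch A z)"
    using gram_integrable unfolding sketch_gram_eq[abs_def] .
  have step_int: "integrable D (\<lambda>z. (norm (f (h, z)))\<^sup>2)" for h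
    unfolding f_def prod.case
    by (rule D.expectation_norm_sq_random_matrix(1)[OF sketch_integrable gram])
  have step_le: "(\<integral>z. (norm (f (h, z)))\<^sup>2 \<partial>D) \<le> g h" for h
  proof -
    let ?u = "fst h" and ?v = "snd h"
    let ?a = "?u + \<omega> *\<^sub>R (?u - ?v)"
    have "(\<integral>z. (norm (f (h, z)))\<^sup>2 \<partial>D)
        = (norm ?a)\<^sup>2 - 2 * \<alpha> * (?a \<bullet> (((1 / F2) *\<^sub>R transpose A) *v (A *v ?u)))
          + \<alpha>\<^sup>2 * ((A *v ?u) \<bullet> (integral\<^sup>L D (sketch_gram A) *v (A *v ?u)))"
      unfolding f_def prod.case F2_def sketch_mean[symmetric] sketch_gram_eq[abs_def]
      by (rule D.expectation_norm_sq_random_matrix(2)[OF sketch_integrable gram])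
    also have "\<dots> \<le> (norm ?a)\<^sup>2 - 2 * \<alpha> * (?a \<bullet> (((1 / F2) *\<^sub>R transpose A) *v (A *v ?u)))
          + \<alpha>\<^sup>2 * (\<beta>1 * (norm (A *v ?u))\<^sup>2)"
      unfolding \<beta>1 by (intro add_left_mono mult_left_mono inner_matrix_le_spectral_norm) auto
    also have "\<dots> \<le> g h"
      unfolding g_def \<gamma>1 \<gamma>2 F2_def[symmetric]
      using \<alpha>_pos by (intro momentum_quadratic_bound full_column_rank \<omega>_nonneg F2_pos step_size) auto
    finally show ?thesis .
  qed

  define E where "E k = M.expectation (\<lambda>\<xi>. (norm (x k \<xi> - e))\<^sup>2)" for k
  \<comment> \<open>The integrability hypothesis starts at index 1; at index 0 the error is
    constant.\<close>
  have x_int: "integrable M (\<lambda>\<xi>. (norm (x k \<xi> - e))\<^sup>2)" for k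
  proof (cases k)
    case 0
    have "integrable M (\<lambda>\<xi>. (norm (x 0 \<xi> - e))\<^sup>2) \<longleftrightarrow> integrable M (\<lambda>_. (norm (x0 - e))\<^sup>2)"
      by (intro Bochner_Integration.integrable_cong) (auto simp: x_0)
    then show ?thesis
      using 0 by simp
  next
    case (Suc j)
    then show ?thesis
      using error_integrable[of j] by (simp add: e_def)
  qed
  have E_rec: "E (k + 2) \<le> \<gamma>1 * E (k + 1) + \<gamma>2 * E k" for k
  proof -
    have "E (k + 2) = M.expectation (\<lambda>\<xi>. (norm (f (H (k + 1) \<xi>, Q (k + 1) \<xi>)))\<^sup>2)"
      unfolding E_def using H_step[of "k + 1"]
      by (intro Bochner_Integration.integral_cong) auto
    also have "\<dots> \<le> M.expectation (\<lambda>\<xi>. g (H (k + 1) \<xi>))"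
    proof (rule M.expectation_joint_distr_le[OF H_Q, where f = "\<lambda>p. (norm (f p))\<^sup>2"])
      show "integrable M (\<lambda>\<xi>. g (H (k + 1) \<xi>))"
        unfolding g_def H_def using x_int[of k] x_int[of "k + 1"] by simp
      show "integrable (distr M borel (Q (k + 1))) (\<lambda>y. (norm (f (h, y)))\<^sup>2)" for h
        using step_int by (simp add: Q_distr)
      show "(\<integral>y. (norm (f (h, y)))\<^sup>2 \<partial>distr M borel (Q (k + 1))) \<le> g h" for h
        using step_le by (simp add: Q_distr)
    qed (use g_meas in auto)
    also have "\<dots> = \<gamma>1 * E (k + 1) + \<gamma>2 * E k"
      unfolding g_def H_def E_def using x_int[of k] x_int[of "k + 1"] by simp
    finally show ?thesis .
  qed

  have E_0: "E 0 = (norm (x0 - e))\<^sup>2" and E_1: "E 1 = E 0"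
    unfolding E_def using x_0 x_1
    by (simp_all add: M.prob_space cong: Bochner_Integration.integral_cong)
  have E_nonneg: "E k \<ge> 0" for k
    by (simp add: E_def)
  have \<omega>_terms: "\<omega> * \<alpha> * ((sigma_max A)\<^sup>2 / (frobenius_norm A)\<^sup>2) \<ge> 0"
    using \<omega>_nonneg \<alpha>_pos by simp
  have \<gamma>2_nonneg: "\<gamma>2 \<ge> 0"
    unfolding \<gamma>2 using \<omega>_terms \<omega>_nonneg by (intro add_nonneg_nonneg) auto
  \<comment> \<open>This matches the case split on \<omega> in the definition of \<open>q\<close>
    with the split on \<gamma>2 in the scalar recursion.\<close>
  have "\<gamma>2 > 0 \<longleftrightarrow> \<omega> > 0"
  proof
    assume "\<omega> > 0"
    then have "2 * \<omega>\<^sup>2 + \<omega> > 0"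
      by (intro add_nonneg_pos) auto
    then show "\<gamma>2 > 0"
      unfolding \<gamma>2 using \<omega>_terms by linarith
  qed (use \<omega>_nonneg in \<open>auto simp: \<gamma>2 less_le\<close>)
  then have q': "q = (if \<gamma>2 > 0 then (\<gamma>1 + sqrt (\<gamma>1\<^sup>2 + 4 * \<gamma>2)) / 2 else \<gamma>1)"
    using q by simp
  note bounds = two_term_recursion_bound[where F = E, OF E_nonneg E_1 E_rec \<gamma>2_nonneg \<gamma>_sum q']
  show ?thesis
    using bounds unfolding \<tau> E_0 by (simp add: E_def e_def)
qed

end
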